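(* Let $I$ be a solvable search instance in which all edges have cost one and $h$ is consistent, zero at goals and strictly positive at non-goals. Let $k\ge1$ be an integer. Suppose that at plateau entry $H_0$ there is no goal in $\mathrm{OPEN}_{\min}$, that $m_0\le k$, and that $h$ is perfect on $B_{\le k}$, i.e. $h(v)=h^*(v)$ for every $v\in B_{\le k}$. Then for every final tie-breaker $\sigma$ and every random outcome, $$\min_\tau X_\tau = X_{[h,\sigma]} = |S_<|+m_0 = |S_<|+\ell^*(I),$$ where the minimum is over all runs of all tie-breakers $\tau$. Thus every low-$h$ strategy minimizes the total expansion count.
   Context: **Search instances.** A search instance is $I=(V,A,c,s,\mathcal G,h)$ with $(V,A)$ a finite directed graph, $c:A\to\mathbb R_{\ge0}$ edge costs, $s\notin\mathcal G$ the initial state, $\mathcal G\subseteq V$ the goals, $h:V\to\mathbb R$ a heuristic, together with a fixed order in which successors of each state are generated. $g^*(v)$ is the least cost of a path from $s$ to $v$, $h^*(v)$ the least cost of a path from $v$ to a goal ($+\infty$ if none). The instance is solvable if $C^*:=h^*(s)<\infty$. $h$ is consistent if $h(u)\le c(u,v)+h(v)$ for all $(u,v)\in A$. **A\* model.** Initially OPEN contains only $s$ with $g(s)=0$, and CLOSED is empty. Each OPEN entry stores its best known $g$-value, parent, first-insertion timestamp and goal status. At a selection point let $\mathrm{OPEN}_{\min}$ be the set of $v\in\mathrm{OPEN}$ minimizing $f(v)=g(v)+h(v)$. If $\mathrm{OPEN}_{\min}$ contains a goal, a goal is selected and the search terminates (goal preference; selecting a goal is not an expansion). Otherwise the tie-breaker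 selects a non-goal in $\mathrm{OPEN}_{\min}$, which is expanded: it is moved from OPEN to CLOSED and all its successors are generated in the given order. A newly encountered state is inserted into OPEN; a strictly smaller tentative $g$ updates an existing OPEN entry's $g$ and parent but keeps its first-insertion timestamp; equal- and higher-cost duplicates are discarded. (With consistent $h$ an expanded state has $g=g^*$ and is never reopened.) **Tie-breakers and counts.** A tie-breaker (strategy) is an arbitrary, possibly randomized, history- and instance-dependent rule for choosing the non-goal of $\mathrm{OPEN}_{\min}$ to expand. A low-$h$ strategy $[h,\sigma]$ always chooses among the states of $\mathrm{OPEN}_{\min}$ of minimum $h$, using the arbitrary rule $\sigma$ for the remaining ties. $X_\tau$ is the number of non-goal states expanded by $\tau$ on $I$ (for a given random outcome). **Layers.** With $f^*(v)=g^*(v)+h(v)$, $S_<$ and $S_=$ are the sets of reachable non-goal states with $f^*(v)<C^*$ and $f^*(v)=C^*$, respectively. For integers $j,k\ge1$, $B_j=\{v\in S_=:h(v)=j\}$ and $B_{\le k}=\bigcup_{j=1}^kB_j$. Let $\Pi^*$ be the set of simple optimal (cost-$C^*$) paths from $s$ to a goal whose only goal is their last state; $\ell^*(I)=\min_{\pi\in\Pi^*}|(\pi\setminus\mathcal G)\cap S_=|$, where $\pi$ is regarded as its set of states. **Plateau entry.** $H_0$ is the configuration at the first selection point of a run at which the minimum $f$-value in OPEN equals $C^*$. (Whether $\mathrm{OPEN}_{\min}$ contains a goal at $H_0$ does not depend on the run; if not, $\mathrm{OPEN}_{\min}$ at $H_0$ equals the set $R$ below in every run.) Define $$R=(\{s\}\cap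 S_=)\cup\{v\in S_=:\exists u\in S_<,\ (u,v)\in A,\ g^*(u)+1=g^*(v)\},\qquad m_0=\min_{v\in R}h(v).$$ *)

theory Defs
  imports "HOL-Library.Extended_Real" "Graph_Theory.Pair_Digraph" "Graph_Theory.Shortest_Path"
begin

section \<open>Search instances\<close>

record 'v search_instance =
  graph :: "'v pair_pre_digraph"
  cost :: "'v \<times> 'v \<Rightarrow> real"
  start :: 'v
  goals :: "'v set"
  heur :: "'v \<Rightarrow> real"
  succs :: "'v \<Rightarrow> 'v list"  \<comment> \<open>successors in generation order\<close>

locale wf_search_instance = pair_fin_digraph "graph I" for I :: "'v search_instance" +
  assumes cost_nonneg: "\<And>a. a \<in> parcs (graph I) \<Longrightarrow> 0 \<le> cost I a"
    and start_in: "start I \<in> pverts (graph I)"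
    and start_not_goal: "start I \<notin> goals I"
    and goals_subset: "goals I \<subseteq> pverts (graph I)"
    and succs_distinct: "\<And>u. u \<in> pverts (graph I) \<Longrightarrow> distinct (succs I u)"
    and set_succs: "\<And>u. u \<in> pverts (graph I) \<Longrightarrow> set (succs I u) = {v. (u, v) \<in> parcs (graph I)}"

text \<open>The library's \<open>\<mu>\<close> is the infimum of the costs of all walks between two vertices; on a
  finite digraph with nonnegative costs it is the least cost of a path, and \<open>\<infinity>\<close> if there is none.\<close>

definition gstar :: "'v search_instance \<Rightarrow> 'v \<Rightarrow> ereal" where
  "gstar I v = wf_digraph.\<mu> (with_proj (graph I)) (cost I) (start I) v"

definition hstar :: "'v search_instance \<Rightarrow> 'v \<Rightarrow> ereal" where
  "hstar I v = (INF t \<in> goals I. wf_digraph.\<mu> (with_proj (graph I)) (cost I) v t)"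

definition Cstar :: "'v search_instance \<Rightarrow> ereal" where
  "Cstar I = hstar I (start I)"

definition solvable :: "'v search_instance \<Rightarrow> bool" where
  "solvable I \<longleftrightarrow> Cstar I < \<infinity>"

definition consistent :: "'v search_instance \<Rightarrow> bool" where
  "consistent I \<longleftrightarrow> (\<forall>(u, v) \<in> parcs (graph I). heur I u \<le> cost I (u, v) + heur I v)"


section \<open>The A* model\<close>

record 'v entry =
  gval :: real
  parent :: "'v option"
  stamp :: nat
  is_goal :: bool

record 'v config =
  OPEN :: "'v \<rightharpoonup> 'v entry"
  CLOSED :: "'v \<rightharpoonup> 'v entry"
  clock :: nat  \<comment> \<open>number of insertions into \<open>OPEN\<close> so far, the next timestamp\<close>

definition initial_config :: "'v search_instance \<Rightarrow> 'v config" where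
  "initial_config I =
    \<lparr> OPEN = [start I \<mapsto> \<lparr> gval = 0, parent = None, stamp = 0, is_goal = (start I \<in> goals I) \<rparr>],
      CLOSED = Map.empty, clock = 1 \<rparr>"

definition fval :: "'v search_instance \<Rightarrow> 'v config \<Rightarrow> 'v \<Rightarrow> real" where
  "fval I C v = gval (the (OPEN C v)) + heur I v"

definition open_min :: "'v search_instance \<Rightarrow> 'v config \<Rightarrow> 'v set" where
  "open_min I C = {v \<in> dom (OPEN C). \<forall>u \<in> dom (OPEN C). fval I C v \<le> fval I C u}"

text \<open>Generation of the successor \<open>v\<close> of \<open>u\<close>, where \<open>g\<close> is the \<open>g\<close>-value of \<open>u\<close>. States in
  \<open>CLOSED\<close> are never reopened: for a consistent heuristic they already carry their optimal \<open>g\<close>-value,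
  so that every duplicate of such a state has equal or higher cost.\<close>

definition generate ::
  "'v search_instance \<Rightarrow> 'v \<Rightarrow> real \<Rightarrow> 'v \<Rightarrow> 'v config \<Rightarrow> 'v config" where
  "generate I u g v C =
    (let g' = g + cost I (u, v) in
     case OPEN C v of
       Some e \<Rightarrow>
         if g' < gval e then C\<lparr>OPEN := (OPEN C)(v \<mapsto> e\<lparr>gval := g', parent := Some u\<rparr>)\<rparr> else C
     | None \<Rightarrow>
         if v \<in> dom (CLOSED C) then C
         else C\<lparr>OPEN := (OPEN C)(v \<mapsto>
                  \<lparr> gval = g', parent = Some u, stamp = clock C, is_goal = (v \<in> goals I) \<rparr>),
                clock := Suc (clock C)\<rparr>)"

definition expand :: "'v search_instance \<Rightarrow> 'v \<Rightarrow> 'v config \<Rightarrow> 'v config" where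
  "expand I u C =
    (let e = the (OPEN C u) in
     fold (generate I u (gval e)) (succs I u)
       (C\<lparr>OPEN := (OPEN C)(u := None), CLOSED := (CLOSED C)(u \<mapsto> e)\<rparr>))"

text \<open>The search stops when a goal is selected (goal preference) or \<open>OPEN\<close> is exhausted.\<close>

definition terminated :: "'v search_instance \<Rightarrow> 'v config \<Rightarrow> bool" where
  "terminated I C \<longleftrightarrow> dom (OPEN C) = {} \<or> open_min I C \<inter> goals I \<noteq> {}"


section \<open>Tie-breakers and runs\<close>

text \<open>A randomized rule is a function of the random outcome \<open>\<omega> :: 'w\<close>. It sees the instance, the
  history of configurations at all selection points so far (most recent first), and the set of
  candidates to choose from. All statements are made per outcome, so no probability measure on
  \<open>'w\<close> is needed.\<close>

type_synonym ('v, 'w) tie_breaker =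
  "'v search_instance \<Rightarrow> 'w \<Rightarrow> 'v config list \<Rightarrow> 'v set \<Rightarrow> 'v"

definition is_tie_breaker :: "('v, 'w) tie_breaker \<Rightarrow> bool" where
  "is_tie_breaker \<tau> \<longleftrightarrow> (\<forall>I \<omega> H S. finite S \<longrightarrow> S \<noteq> {} \<longrightarrow> \<tau> I \<omega> H S \<in> S)"

text \<open>The strategy $[h,\sigma]$.\<close>

definition low_h :: "('v, 'w) tie_breaker \<Rightarrow> ('v, 'w) tie_breaker" where
  "low_h \<sigma> I \<omega> H S = \<sigma> I \<omega> H {v \<in> S. \<forall>u \<in> S. heur I v \<le> heur I u}"

lemma is_tie_breaker_low_h:
  assumes "is_tie_breaker \<sigma>"
  shows "is_tie_breaker (low_h \<sigma>)"
  unfolding is_tie_breaker_def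
proof (intro allI impI)
  fix I :: "'a search_instance" and \<omega> H and S :: "'a set"
  assume S: "finite S" "S \<noteq> {}"
  let ?M = "{v \<in> S. \<forall>u \<in> S. heur I v \<le> heur I u}"
  have "arg_min_on (heur I) S \<in> ?M"
    using S by (auto simp: arg_min_if_finite(1) intro: arg_min_least)
  hence "finite ?M" "?M \<noteq> {}" using S by auto
  hence "\<sigma> I \<omega> H ?M \<in> ?M" using assms unfolding is_tie_breaker_def by blast
  thus "low_h \<sigma> I \<omega> H S \<in> S" by (simp add: low_h_def)
qed

text \<open>The history up to the selection point after \<open>n\<close> expansions; it stays constant once the search
  has terminated.\<close>

primrec history ::
  "('v, 'w) tie_breaker \<Rightarrow> 'v search_instance \<Rightarrow> 'w \<Rightarrow> nat \<Rightarrow> 'v config list" where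
  "history \<tau> I \<omega> 0 = [initial_config I]"
| "history \<tau> I \<omega> (Suc n) =
    (let H = history \<tau> I \<omega> n; C = hd H in
     if terminated I C then H
     else expand I (\<tau> I \<omega> H (open_min I C - goals I)) C # H)"

definition config_at ::
  "('v, 'w) tie_breaker \<Rightarrow> 'v search_instance \<Rightarrow> 'w \<Rightarrow> nat \<Rightarrow> 'v config" where
  "config_at \<tau> I \<omega> n = hd (history \<tau> I \<omega> n)"

text \<open>The count \<open>X\<close>; a state is in \<open>CLOSED\<close> iff it has been expanded.\<close>

definition expansions :: "('v, 'w) tie_breaker \<Rightarrow> 'v search_instance \<Rightarrow> 'w \<Rightarrow> nat" where
  "expansions \<tau> I \<omega> =
    card {v \<in> pverts (graph I) - goals I. \<exists>n. v \<in> dom (CLOSED (config_at \<tau> I \<omega> n))}"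


section \<open>Layers and plateau entry\<close>

definition fstar :: "'v search_instance \<Rightarrow> 'v \<Rightarrow> ereal" where
  "fstar I v = gstar I v + ereal (heur I v)"

definition S_less :: "'v search_instance \<Rightarrow> 'v set" where
  "S_less I = {v \<in> pverts (graph I) - goals I.
     start I \<rightarrow>\<^sup>*\<^bsub>with_proj (graph I)\<^esub> v \<and> fstar I v < Cstar I}"

definition S_eq :: "'v search_instance \<Rightarrow> 'v set" where
  "S_eq I = {v \<in> pverts (graph I) - goals I.
     start I \<rightarrow>\<^sup>*\<^bsub>with_proj (graph I)\<^esub> v \<and> fstar I v = Cstar I}"

definition layer :: "'v search_instance \<Rightarrow> nat \<Rightarrow> 'v set" where
  "layer I j = {v \<in> S_eq I. heur I v = real j}"

definition layers_upto :: "'v search_instance \<Rightarrow> nat \<Rightarrow> 'v set" where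
  "layers_upto I k = (\<Union>j \<in> {1..k}. layer I j)"

text \<open>The state sets of simple optimal paths from the start to a goal whose only goal is their last
  state.\<close>

definition optimal_path_sets :: "'v search_instance \<Rightarrow> 'v set set" where
  "optimal_path_sets I =
    {set (pre_digraph.awalk_verts (with_proj (graph I)) (start I) p) | p t.
       t \<in> goals I \<and> pre_digraph.apath (with_proj (graph I)) (start I) p t \<and>
       ereal (wf_digraph.awalk_cost (cost I) p) = Cstar I \<and>
       set (pre_digraph.awalk_verts (with_proj (graph I)) (start I) p) \<inter> goals I = {t}}"

definition ell_star :: "'v search_instance \<Rightarrow> nat" where
  "ell_star I = Min ((\<lambda>P. card ((P - goals I) \<inter> S_eq I)) ` optimal_path_sets I)"

definition min_f_is_Cstar :: "'v search_instance \<Rightarrow> 'v config \<Rightarrow> bool" where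
  "min_f_is_Cstar I C \<longleftrightarrow> (\<exists>v \<in> open_min I C. ereal (fval I C v) = Cstar I)"

definition plateau_entry ::
  "('v, 'w) tie_breaker \<Rightarrow> 'v search_instance \<Rightarrow> 'w \<Rightarrow> 'v config \<Rightarrow> bool" where
  "plateau_entry \<tau> I \<omega> H\<^sub>0 \<longleftrightarrow>
    (\<exists>n. H\<^sub>0 = config_at \<tau> I \<omega> n \<and> min_f_is_Cstar I H\<^sub>0 \<and>
         (\<forall>m < n. \<not> min_f_is_Cstar I (config_at \<tau> I \<omega> m)))"

definition entry_set :: "'v search_instance \<Rightarrow> 'v set" where
  "entry_set I = ({start I} \<inter> S_eq I) \<union>
    {v \<in> S_eq I. \<exists>u \<in> S_less I. (u, v) \<in> parcs (graph I) \<and> gstar I u + 1 = gstar I v}"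

definition m0 :: "'v search_instance \<Rightarrow> real" where
  "m0 I = Min (heur I ` entry_set I)"

end

(* With unit costs, a state of S_= at depth d has h = C* - d, so h drops by exactly one along every
   optimal path through the plateau.  A goal at depth C* has a chain of optimal predecessors among
   the expanded states; followed backwards it climbs through the values h = 1, 2, ... and can leave
   S_= only at a state of R, whose h is at least m0.  Hence every run expands at least m0 states of
   S_= besides all of S_<, and every optimal path contains at least m0 of them.  Conversely, a
   low-h run starts on the plateau at a state with h = m0, and since h = h* there, every expansion
   produces a state of S_= with h one smaller, until a goal appears after m0 expansions. *)

theory Submission
  imports Defs
begin

text \<open>The two lower bounds, for runs and for optimal paths, are one statement about sets. The
  expanded states of a run and the non-goal states of an optimal path both contain an optimal
  predecessor of each of their members other than the start; this is
  \<open>closed_under_tight_pred\<close>. The hypothesis on \<open>H\<^sub>0\<close> concerns a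
  single reference run, while all runs are compared. It is therefore turned into a statement without
  runs: no state of S_< is an optimal predecessor of an optimal goal, so the last state before the
  goal lies in S_= and has h = 1. In the descent, the danger is that OPEN_min contains a plateau
  state with h below the current value j. Such a state would lie in R, where h is at least m0, or
  have an expanded optimal predecessor in S_= with h at most j, whereas all expanded plateau states
  have h > j.\<close>

text \<open>Only the \<open>g\<close>-values of the entries matter: parents, timestamps and goal flags never
  influence which states are expanded.\<close>

definition open_g :: "'v config \<Rightarrow> 'v \<Rightarrow> real option" where
  "open_g C v = map_option gval (OPEN C v)"

section \<open>Effect of generation and expansion on the g-values in OPEN\<close>

lemma open_min_iff:
  "v \<in> open_min I C \<longleftrightarrow>
    (\<exists>a. open_g C v = Some a \<and> (\<forall>w b. open_g C w = Some b \<longrightarrow> a + heur I v \<le> b + heur I w))"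
proof -
  have "v \<in> open_min I C \<longleftrightarrow> (\<exists>e. OPEN C v = Some e \<and>
      (\<forall>w e'. OPEN C w = Some e' \<longrightarrow> gval e + heur I v \<le> gval e' + heur I w))"
    unfolding open_min_def fval_def by (simp add: dom_def) (metis option.sel)
  then show ?thesis
    unfolding open_g_def by auto
qed

lemma CLOSED_generate [simp]: "CLOSED (generate I u g v C) = CLOSED C"
  by (simp add: generate_def Let_def split: option.split)

lemma open_g_generate:
  "open_g (generate I u g v C) x =
    (if x = v
     then case open_g C v of
            Some a \<Rightarrow> Some (min a (g + cost I (u, v)))
          | None \<Rightarrow> if v \<in> dom (CLOSED C) then None else Some (g + cost I (u, v))
     else open_g C x)"
  by (auto simp: generate_def open_g_def Let_def min_def split: option.split)

lemma CLOSED_fold_generate [simp]: "CLOSED (fold (generate I u g) vs C) = CLOSED C"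
  by (induction vs arbitrary: C) auto

text \<open>Generating \<open>x\<close> again takes the minimum with the same value and changes
  nothing, so only membership in \<open>vs\<close> matters.\<close>

lemma open_g_fold_generate:
  "open_g (fold (generate I u g) vs C) x =
    (if x \<in> set vs
     then case open_g C x of
            Some a \<Rightarrow> Some (min a (g + cost I (u, x)))
          | None \<Rightarrow> if x \<in> dom (CLOSED C) then None else Some (g + cost I (u, x))
     else open_g C x)"
proof (induction vs arbitrary: C)
  case Nil
  then show ?case by simp
next
  case (Cons y vs)
  show ?case
    by (auto simp: Cons.IH open_g_generate split: option.split)
qed

lemma CLOSED_expand: "dom (CLOSED (expand I u C)) = insert u (dom (CLOSED C))"
  by (auto simp: expand_def Let_def)

text \<open>\<open>u\<close> is moved to CLOSED before its successors are generated, so a self-loop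
  cannot reinsert it; hence the special treatment of \<open>x = u\<close>.\<close>

lemma open_g_expand:
  assumes "open_g C u = Some g"
  shows "open_g (expand I u C) x =
    (if x \<in> set (succs I u)
     then case (if x = u then None else open_g C x) of
            Some a \<Rightarrow> Some (min a (g + cost I (u, x)))
          | None \<Rightarrow> if x \<in> insert u (dom (CLOSED C)) then None else Some (g + cost I (u, x))
     else if x = u then None else open_g C x)"
proof -
  have "gval (the (OPEN C u)) = g"
    using assms by (auto simp: open_g_def)
  then show ?thesis
    by (simp add: expand_def Let_def open_g_fold_generate) (simp add: open_g_def)
qed

section \<open>Unit costs: depths, optimal predecessors and the layers\<close>

locale unit_search_instance = wf_search_instance I for I :: "'v search_instance" +
  assumes unit_cost: "a \<in> parcs (graph I) \<Longrightarrow> cost I a = 1"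
    and solvable: "solvable I"
    and consistent: "consistent I"
    and heur_goal: "v \<in> goals I \<Longrightarrow> heur I v = 0"
    and heur_nongoal: "v \<in> pverts (graph I) - goals I \<Longrightarrow> heur I v > 0"
begin

abbreviation reach :: "'v \<Rightarrow> bool" where
  "reach v \<equiv> start I \<rightarrow>\<^sup>*\<^bsub>with_proj (graph I)\<^esub> v"

abbreviation edge :: "'v \<Rightarrow> 'v \<Rightarrow> bool" where
  "edge u v \<equiv> (u, v) \<in> parcs (graph I)"

text \<open>With unit costs, \<open>depth\<close>, \<open>fopt\<close> and \<open>opt\<close>
  replace the extended reals \<open>gstar\<close>, \<open>fstar\<close> and \<open>Cstar\<close> by
  finite numbers. For unreachable states \<open>depth\<close> is unspecified, so
  \<open>reach\<close> accompanies its use.\<close>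

definition depth :: "'v \<Rightarrow> nat" where
  "depth v = (LEAST n. \<exists>p. awalk (start I) p v \<and> length p = n)"

definition fopt :: "'v \<Rightarrow> real" where
  "fopt v = real (depth v) + heur I v"

definition opt :: nat where
  "opt = (LEAST n. \<exists>t \<in> goals I. reach t \<and> depth t = n)"

lemma reach_in_pverts: "reach v \<Longrightarrow> v \<in> pverts (graph I)"
  using reachable_in_verts(2) by fastforce

lemma reach_start: "reach (start I)"
  using start_in by (intro reachable_awalkI[of _ "[]"]) (simp add: awalk_Nil_iff)

lemma awalk_cost_eq_length: "awalk u p v \<Longrightarrow> awalk_cost (cost I) p = real (length p)"
  by (induction p arbitrary: u) (auto simp: awalk_Cons_iff unit_cost)

lemma heur_le_awalk: "awalk u p v \<Longrightarrow> heur I u \<le> real (length p) + heur I v"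
proof (induction p arbitrary: u)
  case Nil
  then show ?case by (simp add: awalk_Nil_iff)
next
  case (Cons e p)
  then have "e \<in> parcs (graph I)" "u = fst e" and p: "awalk (snd e) p v"
    by (auto simp: awalk_Cons_iff)
  then have "heur I u \<le> 1 + heur I (snd e)"
    using consistent unit_cost[of e] unfolding consistent_def by (cases e) fastforce
  with Cons.IH[OF p] show ?case by simp
qed

lemma heur_edge: "edge u v \<Longrightarrow> heur I u \<le> 1 + heur I v"
  using consistent unit_cost[of "(u, v)"] unfolding consistent_def by fastforce

lemma depth_le: "awalk (start I) p v \<Longrightarrow> depth v \<le> length p"
  unfolding depth_def by (rule Least_le) blast

lemma depth_awalk:
  assumes "reach v"
  obtains p where "awalk (start I) p v" "length p = depth v"
proof -
  have "\<exists>n p. awalk (start I) p v \<and> length p = n"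
    using assms by (auto simp: reachable_awalk)
  from LeastI_ex[OF this] show ?thesis
    using that unfolding depth_def by blast
qed

lemma depth_awalk_le:
  assumes "reach u" "awalk u p v"
  shows "reach v" "depth v \<le> depth u + length p"
proof -
  obtain q where q: "awalk (start I) q u" "length q = depth u"
    using depth_awalk[OF assms(1)] .
  then have qp: "awalk (start I) (q @ p) v"
    using assms(2) by (auto intro: awalk_appendI)
  show "reach v"
    by (rule reachable_awalkI[OF qp])
  show "depth v \<le> depth u + length p"
    using depth_le[OF qp] q(2) by simp
qed

lemma edge_awalk: "edge u v \<Longrightarrow> awalk u [(u, v)] v"
  using in_arcsD1 in_arcsD2 by (fastforce simp: awalk_simps)

lemma depth_edge:
  assumes "reach u" "edge u v"
  shows "reach v" "depth v \<le> Suc (depth u)"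
  using depth_awalk_le[OF assms(1) edge_awalk[OF assms(2)]] by auto

lemma depth_start [simp]: "depth (start I) = 0"
  using depth_le[of "[]" "start I"] start_in by (simp add: awalk_Nil_iff)

text \<open>Between reachable states these are the edges of the shortest-path DAG from the
  start.\<close>

definition tight :: "'v \<Rightarrow> 'v \<Rightarrow> bool" where
  "tight u v \<longleftrightarrow> edge u v \<and> depth v = Suc (depth u)"

lemma tight_pred:
  assumes "reach v" "v \<noteq> start I"
  obtains u where "reach u" "tight u v"
proof -
  obtain p where p: "awalk (start I) p v" "length p = depth v"
    using depth_awalk[OF assms(1)] .
  with assms(2) obtain q e where pq: "p = q @ [e]"
    by (cases p rule: rev_cases) (auto simp: awalk_Nil_iff)
  then have q: "awalk (start I) q (fst e)" and e: "e \<in> parcs (graph I)" "v = snd e"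
    using p(1) by (auto simp: awalk_simps)
  then have "reach (fst e)" "edge (fst e) v"
    by (auto simp: reachable_awalk)
  moreover have "depth v = Suc (depth (fst e))"
    using depth_edge(2)[OF calculation] depth_le[OF q] p(2) pq by simp
  ultimately show ?thesis
    using that unfolding tight_def by blast
qed

text \<open>Consistency: \<open>heur\<close> drops by at most the one unit that the depth
  gains.\<close>

lemma fopt_mono: "tight u v \<Longrightarrow> fopt u \<le> fopt v"
  using heur_edge[of u v] unfolding fopt_def tight_def by simp

lemma gstar_eq_depth:
  assumes "reach v"
  shows "gstar I v = ereal (real (depth v))"
proof -
  obtain p where p: "awalk (start I) p v" "length p = depth v"
    using depth_awalk[OF assms] .
  show ?thesis
    unfolding gstar_def \<mu>_def
  proof (rule INF_eqI)
    fix q assume "q \<in> {p. awalk (start I) p v}"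
    then show "ereal (real (depth v)) \<le> ereal (awalk_cost (cost I) q)"
      using depth_le by (simp add: awalk_cost_eq_length)
  next
    fix y assume *: "\<And>q. q \<in> {p. awalk (start I) p v} \<Longrightarrow> y \<le> ereal (awalk_cost (cost I) q)"
    show "y \<le> ereal (real (depth v))"
      using *[of p] p by (simp add: awalk_cost_eq_length)
  qed
qed

lemma fstar_eq_fopt: "reach v \<Longrightarrow> fstar I v = ereal (fopt v)"
  by (simp add: fstar_def gstar_eq_depth fopt_def)

lemma ex_reach_goal: "\<exists>t \<in> goals I. reach t"
proof -
  have "(INF t \<in> goals I. \<mu> (cost I) (start I) t) < \<infinity>"
    using solvable unfolding solvable_def Cstar_def hstar_def .
  then obtain t where "t \<in> goals I" "\<mu> (cost I) (start I) t < \<infinity>"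
    unfolding INF_less_iff by blast
  then show ?thesis
    using \<mu>_reach_conv by blast
qed

lemma opt_le: "t \<in> goals I \<Longrightarrow> reach t \<Longrightarrow> opt \<le> depth t"
  unfolding opt_def by (rule Least_le) blast

lemma opt_attained: obtains t where "t \<in> goals I" "reach t" "depth t = opt"
proof -
  have "\<exists>n. \<exists>t \<in> goals I. reach t \<and> depth t = n"
    using ex_reach_goal by blast
  from LeastI_ex[OF this] show ?thesis
    using that unfolding opt_def by blast
qed

text \<open>Unreachable goals contribute infinity to the infimum; the reachable ones contribute
  their depths.\<close>

lemma Cstar_eq_opt: "Cstar I = ereal (real opt)"
proof -
  have C: "Cstar I = (INF t \<in> goals I. gstar I t)"
    unfolding Cstar_def hstar_def gstar_def ..
  obtain t0 where t0: "t0 \<in> goals I" "reach t0" "depth t0 = opt"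
    using opt_attained .
  show ?thesis
    unfolding C
  proof (rule INF_eqI)
    fix t assume t: "t \<in> goals I"
    show "ereal (real opt) \<le> gstar I t"
    proof (cases "reach t")
      case True
      then show ?thesis using opt_le[OF t] by (simp add: gstar_eq_depth)
    next
      case False
      then show ?thesis by (simp add: gstar_def shortest_path_inf)
    qed
  next
    fix y assume "\<And>t. t \<in> goals I \<Longrightarrow> y \<le> gstar I t"
    from this[OF t0(1)] show "y \<le> ereal (real opt)"
      using t0 by (simp add: gstar_eq_depth)
  qed
qed

lemma S_less_iff: "v \<in> S_less I \<longleftrightarrow> reach v \<and> v \<notin> goals I \<and> fopt v < opt"
  using reach_in_pverts by (auto simp: S_less_def fstar_eq_fopt Cstar_eq_opt)

lemma S_eq_iff: "v \<in> S_eq I \<longleftrightarrow> reach v \<and> v \<notin> goals I \<and> fopt v = opt"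
  using reach_in_pverts by (auto simp: S_eq_def fstar_eq_fopt Cstar_eq_opt)

lemma finite_layers: "finite (S_less I)" "finite (S_eq I)"
  by (auto simp: S_less_def S_eq_def)

lemma heur_pos: "reach v \<Longrightarrow> v \<notin> goals I \<Longrightarrow> heur I v > 0"
  using heur_nongoal reach_in_pverts by blast

lemma entry_set_iff:
  "v \<in> entry_set I \<longleftrightarrow> v \<in> S_eq I \<and> (v = start I \<or> (\<exists>u \<in> S_less I. tight u v))"
proof -
  have "gstar I u + 1 = gstar I v \<longleftrightarrow> depth v = Suc (depth u)" if "reach u" "reach v" for u v
    using that by (auto simp: gstar_eq_depth one_ereal_def)
  then show ?thesis
    unfolding entry_set_def tight_def by (auto simp: S_less_iff S_eq_iff)
qed

text \<open>Positivity of \<open>heur\<close> off the goals makes the truncated subtraction exact,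
  so a tight step inside \<open>S_eq\<close> lowers \<open>heur\<close> by exactly one.\<close>

lemma S_eq_heur: "v \<in> S_eq I \<Longrightarrow> heur I v = real (opt - depth v) \<and> depth v < opt"
  using heur_pos[of v] by (auto simp: S_eq_iff fopt_def of_nat_diff)

section \<open>The search invariant and optimality of g-values at selection\<close>

text \<open>The common abstraction of a CLOSED set and of the non-goal states on an optimal path;
  the bound by \<open>m0\<close> is proved once, for all such sets.\<close>

definition closed_under_tight_pred :: "'v set \<Rightarrow> bool" where
  "closed_under_tight_pred K \<longleftrightarrow>
    (\<forall>v \<in> K. reach v \<and> v \<notin> goals I \<and> fopt v \<le> opt \<and> (v = start I \<or> (\<exists>u \<in> K. tight u v)))"

text \<open>Values in OPEN are tied to \<open>depth u\<close> of an expanded \<open>u\<close> rather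
  than to its stored g-value. This encodes that states are expanded only with their optimal
  g.\<close>

definition search_inv :: "'v config \<Rightarrow> bool" where
  "search_inv C \<longleftrightarrow>
    (let K = dom (CLOSED C) in
      closed_under_tight_pred K \<and>
      (\<forall>v a. open_g C v = Some a \<longrightarrow> v \<notin> K \<and>
        (v = start I \<and> a = 0 \<or> (\<exists>u \<in> K. edge u v \<and> a = real (depth u) + 1))) \<and>
      (\<forall>u \<in> K. \<forall>v. edge u v \<longrightarrow>
        v \<in> K \<or> (\<exists>a. open_g C v = Some a \<and> a \<le> real (depth u) + 1)) \<and>
      (start I \<in> K \<or> (\<exists>a. open_g C (start I) = Some a \<and> a \<le> 0)))"

lemma search_inv_initial: "search_inv (initial_config I)"
  by (auto simp: search_inv_def closed_under_tight_pred_def initial_config_def open_g_def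
      split: if_splits)

context
  fixes C
  assumes inv: "search_inv C"
begin

lemma inv_closed: "closed_under_tight_pred (dom (CLOSED C))"
  using inv unfolding search_inv_def Let_def by blast

lemma inv_open:
  "open_g C v = Some a \<Longrightarrow> v \<notin> dom (CLOSED C) \<and>
    (v = start I \<and> a = 0 \<or> (\<exists>u \<in> dom (CLOSED C). edge u v \<and> a = real (depth u) + 1))"
  using inv unfolding search_inv_def Let_def by blast

lemma inv_succ:
  "u \<in> dom (CLOSED C) \<Longrightarrow> edge u v \<Longrightarrow>
    v \<in> dom (CLOSED C) \<or> (\<exists>a. open_g C v = Some a \<and> a \<le> real (depth u) + 1)"
  using inv unfolding search_inv_def Let_def by blast

lemma inv_start:
  "start I \<in> dom (CLOSED C) \<or> (\<exists>a. open_g C (start I) = Some a \<and> a \<le> 0)"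
  using inv unfolding search_inv_def Let_def by blast

lemma closed_reach: "u \<in> dom (CLOSED C) \<Longrightarrow> reach u"
  using inv_closed unfolding closed_under_tight_pred_def by blast

lemma closed_not_goal: "u \<in> dom (CLOSED C) \<Longrightarrow> u \<notin> goals I"
  using inv_closed unfolding closed_under_tight_pred_def by blast

lemma open_reach:
  assumes "open_g C v = Some a"
  shows "reach v" "real (depth v) \<le> a"
proof -
  consider "v = start I" "a = 0"
    | u where "u \<in> dom (CLOSED C)" "edge u v" "a = real (depth u) + 1"
    using inv_open[OF assms] by blast
  then have "reach v \<and> real (depth v) \<le> a"
  proof cases
    case 1
    then show ?thesis using reach_start by simp
  next
    case (2 u)
    then show ?thesis using depth_edge[OF closed_reach[OF 2(1)] 2(2)] by simp
  qed
  then show "reach v" "real (depth v) \<le> a" by auto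
qed

text \<open>The classical frontier argument: following tight predecessors back from
  \<open>v\<close>, the first state with an expanded predecessor, or else the start, sits in OPEN
  with its optimal g. By consistency its f-value is no larger than that of \<open>v\<close>.\<close>

lemma frontier:
  assumes "reach v" "v \<notin> dom (CLOSED C)"
  shows "\<exists>w. open_g C w = Some (real (depth w)) \<and> fopt w \<le> fopt v"
  using assms
proof (induction "depth v" arbitrary: v)
  case 0
  have "v = start I"
    using tight_pred[OF 0(2)] 0(1) by (fastforce simp: tight_def)
  then show ?case
    using inv_start 0(3) open_reach(2)[of "start I"] by (metis order_antisym depth_start of_nat_0 order_refl)
next
  case (Suc n)
  then have "v \<noteq> start I" by auto
  then obtain u where u: "reach u" "tight u v"
    using tight_pred Suc.prems by blast
  show ?case
  proof (cases "u \<in> dom (CLOSED C)")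
    case True
    then obtain a where "open_g C v = Some a" "a \<le> real (depth u) + 1"
      using inv_succ u(2) Suc.prems unfolding tight_def by blast
    moreover from this have "a = real (depth v)"
      using open_reach(2)[of v a] u(2) unfolding tight_def by simp
    ultimately show ?thesis by auto
  next
    case False
    then obtain w where "open_g C w = Some (real (depth w))" "fopt w \<le> fopt u"
      using Suc.hyps(1)[of u] Suc.hyps(2) u unfolding tight_def by auto
    then show ?thesis
      using fopt_mono[OF u(2)] by auto
  qed
qed

lemma open_min_props:
  assumes "v \<in> open_min I C"
  shows open_min_depth: "open_g C v = Some (real (depth v))"
    and open_min_reach: "reach v"
    and open_min_not_closed: "v \<notin> dom (CLOSED C)"
    and open_min_le: "\<And>x. reach x \<Longrightarrow> x \<notin> dom (CLOSED C) \<Longrightarrow> fopt v \<le> fopt x"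
    and open_min_tight_pred: "v = start I \<or> (\<exists>u \<in> dom (CLOSED C). tight u v)"
proof -
  obtain a where a: "open_g C v = Some a"
    and min: "\<And>w b. open_g C w = Some b \<Longrightarrow> a + heur I v \<le> b + heur I w"
    using assms by (auto simp: open_min_iff)
  show v: "reach v" "v \<notin> dom (CLOSED C)"
    using open_reach[OF a] inv_open[OF a] by auto
  obtain w where "open_g C w = Some (real (depth w))" "fopt w \<le> fopt v"
    using frontier[OF v] by blast
  \<comment> \<open>Minimality of \<open>v\<close> against \<open>w\<close> gives a + h(v) <= fopt w
    <= fopt v = depth v + h(v).\<close>
  then have "a \<le> real (depth v)"
    using min by (fastforce simp: fopt_def)
  then have a_eq: "a = real (depth v)"
    using open_reach[OF a] by simp
  then show "open_g C v = Some (real (depth v))"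
    using a by simp
  show "fopt v \<le> fopt x" if x: "reach x" "x \<notin> dom (CLOSED C)" for x
    using frontier[OF x] min a_eq by (fastforce simp: fopt_def)
  have "(v = start I \<and> a = 0 \<or> (\<exists>u \<in> dom (CLOSED C). edge u v \<and> a = real (depth u) + 1))"
    using inv_open[OF a] by blast
  then show "v = start I \<or> (\<exists>u \<in> dom (CLOSED C). tight u v)"
    unfolding tight_def a_eq by (metis Suc_eq_plus1 of_nat_1 of_nat_add of_nat_eq_iff)
qed

text \<open>A goal at depth \<open>opt\<close> is never expanded, so \<open>open_min_le\<close>
  compares every selected state with it.\<close>

lemma open_min_le_opt: "v \<in> open_min I C \<Longrightarrow> fopt v \<le> opt"
proof -
  assume v: "v \<in> open_min I C"
  obtain t where t: "t \<in> goals I" "reach t" "depth t = opt"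
    using opt_attained .
  then have "fopt v \<le> fopt t"
    using open_min_le[OF v] closed_not_goal by blast
  then show ?thesis
    using t heur_goal by (simp add: fopt_def)
qed

text \<open>A reachable goal is never expanded, so \<open>frontier\<close> always finds a state in
  OPEN.\<close>

lemma open_min_nonempty: "open_min I C \<noteq> {}" and finite_open_min: "finite (open_min I C)"
proof -
  have sub: "dom (OPEN C) \<subseteq> pverts (graph I)"
    using open_reach(1) reach_in_pverts by (fastforce simp: open_g_def)
  then have fin: "finite (dom (OPEN C))"
    by (rule finite_subset) simp
  then show "finite (open_min I C)"
    unfolding open_min_def by simp
  obtain t where "t \<in> goals I" "reach t"
    using ex_reach_goal by blast
  then obtain w where "open_g C w = Some (real (depth w))"
    using frontier closed_not_goal by blast
  then have "dom (OPEN C) \<noteq> {}"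
    by (auto simp: open_g_def)
  with fin have "arg_min_on (fval I C) (dom (OPEN C)) \<in> open_min I C"
    unfolding open_min_def by (auto simp: arg_min_if_finite(1) intro: arg_min_least)
  then show "open_min I C \<noteq> {}" by blast
qed

lemma terminated_iff: "terminated I C \<longleftrightarrow> open_min I C \<inter> goals I \<noteq> {}"
  using open_min_nonempty by (auto simp: terminated_def open_min_def)

text \<open>By \<open>open_min_depth\<close> the stored value of \<open>u\<close> is
  \<open>depth u\<close>, so each new or improved entry is \<open>depth u + 1\<close> with
  \<open>u\<close> as its witness; entries that keep their value keep their old witness.\<close>

lemma search_inv_expand:
  assumes u: "u \<in> open_min I C" "u \<notin> goals I"
  shows "search_inv (expand I u C)"
proof -
  let ?K = "dom (CLOSED C)" and ?C = "expand I u C"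
  note u_props = open_min_props[OF u(1)]
  have K: "dom (CLOSED ?C) = insert u ?K"
    by (rule CLOSED_expand)
  have u_vert: "u \<in> pverts (graph I)"
    using u_props(2) by (rule reach_in_pverts)
  have succ: "x \<in> set (succs I u) \<longleftrightarrow> edge u x" for x
    using set_succs[OF u_vert] by simp
  have og: "open_g ?C x =
    (if x = u then None
     else if edge u x
     then case open_g C x of
            Some a \<Rightarrow> Some (min a (real (depth u) + 1))
          | None \<Rightarrow> if x \<in> ?K then None else Some (real (depth u) + 1)
     else open_g C x)" for x
    unfolding open_g_expand[OF u_props(1)] succ
    using unit_cost[of "(u, x)"] by (auto split: option.split)
  have "closed_under_tight_pred (insert u ?K)"
    using inv_closed u_props(2,5) u open_min_le_opt unfolding closed_under_tight_pred_def by blast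
  moreover have "v \<notin> insert u ?K \<and>
      (v = start I \<and> a = 0 \<or> (\<exists>x \<in> insert u ?K. edge x v \<and> a = real (depth x) + 1))"
    if "open_g ?C v = Some a" for v a
    using that inv_open[of v] unfolding og
    by (cases "open_g C v") (auto simp: min_def split: if_splits)
  moreover have "v \<in> insert u ?K \<or> (\<exists>a. open_g ?C v = Some a \<and> a \<le> real (depth x) + 1)"
    if "x \<in> insert u ?K" "edge x v" for x v
  proof (cases "x = u")
    case True
    then show ?thesis
      using that unfolding og by (auto split: option.split)
  next
    case False
    then have "v \<in> ?K \<or> (\<exists>a. open_g C v = Some a \<and> a \<le> real (depth x) + 1)"
      using that inv_succ[of x v] by blast
    then show ?thesis
      unfolding og by (auto simp: min_def)
  qed
  moreover have "start I \<in> insert u ?K \<or> (\<exists>a. open_g ?C (start I) = Some a \<and> a \<le> 0)"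
    using inv_start unfolding og by auto
  ultimately show ?thesis
    unfolding search_inv_def Let_def K by blast
qed

end

section \<open>Runs of a tie-breaker: termination and counting\<close>

lemma config_at_0 [simp]: "config_at \<tau> I \<omega> 0 = initial_config I"
  by (simp add: config_at_def)

lemma config_at_Suc:
  "config_at \<tau> I \<omega> (Suc n) =
    (if terminated I (config_at \<tau> I \<omega> n) then config_at \<tau> I \<omega> n
     else expand I (\<tau> I \<omega> (history \<tau> I \<omega> n) (open_min I (config_at \<tau> I \<omega> n) - goals I))
            (config_at \<tau> I \<omega> n))"
  by (simp add: config_at_def Let_def)

lemma closed_subset_layers:
  assumes "closed_under_tight_pred K"
  shows "K \<subseteq> S_less I \<union> S_eq I"
  using assms unfolding closed_under_tight_pred_def by (force simp: S_less_iff S_eq_iff)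

lemma finite_closed: "search_inv C \<Longrightarrow> finite (dom (CLOSED C))"
  by (meson closed_subset_layers finite_UnI finite_layers finite_subset inv_closed)

context
  fixes \<tau> :: "('v, 'w) tie_breaker" and \<omega> :: 'w
  assumes tie_breaker: "is_tie_breaker \<tau>"
begin

lemma choice_in:
  assumes "search_inv C" "\<not> terminated I C"
  shows "\<tau> I \<omega> H (open_min I C - goals I) \<in> open_min I C - goals I"
proof -
  have "finite (open_min I C - goals I)" "open_min I C - goals I \<noteq> {}"
    using assms finite_open_min[OF assms(1)] open_min_nonempty[OF assms(1)] terminated_iff[OF assms(1)]
    by auto
  then show ?thesis
    using tie_breaker unfolding is_tie_breaker_def by blast
qed

lemma search_inv_config_at: "search_inv (config_at \<tau> I \<omega> n)"
proof (induction n)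
  case 0
  show ?case by (simp add: search_inv_initial)
next
  case (Suc n)
  then show ?case
    unfolding config_at_Suc using choice_in[OF Suc] search_inv_expand[OF Suc] by auto
qed

text \<open>Every step closes a state that was not closed before. Besides counting, this bounds the
  length of a run.\<close>

lemma card_closed_config_at:
  "\<not> terminated I (config_at \<tau> I \<omega> n) \<Longrightarrow> card (dom (CLOSED (config_at \<tau> I \<omega> n))) = n"
proof (induction n)
  case 0
  show ?case by (simp add: initial_config_def)
next
  case (Suc n)
  let ?C = "config_at \<tau> I \<omega> n"
  let ?u = "\<tau> I \<omega> (history \<tau> I \<omega> n) (open_min I ?C - goals I)"
  have nt: "\<not> terminated I ?C"
    using Suc.prems by (auto simp: config_at_Suc split: if_splits)
  have "?u \<notin> dom (CLOSED ?C)"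
    using open_min_not_closed choice_in nt search_inv_config_at by blast
  then show ?case
    using nt Suc.IH finite_closed[OF search_inv_config_at]
    by (simp add: config_at_Suc CLOSED_expand)
qed

lemma closed_config_at_mono:
  "n \<le> m \<Longrightarrow> dom (CLOSED (config_at \<tau> I \<omega> n)) \<subseteq> dom (CLOSED (config_at \<tau> I \<omega> m))"
  by (rule lift_Suc_mono_le[of "\<lambda>n. dom (CLOSED (config_at \<tau> I \<omega> n))"])
    (auto simp: config_at_Suc CLOSED_expand)

lemma config_at_terminated:
  "terminated I (config_at \<tau> I \<omega> n) \<Longrightarrow> n \<le> m \<Longrightarrow> config_at \<tau> I \<omega> m = config_at \<tau> I \<omega> n"
  by (rotate_tac, induction m rule: dec_induct) (auto simp: config_at_Suc)

lemma expansions_eq: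
  obtains n where "terminated I (config_at \<tau> I \<omega> n)"
    "expansions \<tau> I \<omega> = card (dom (CLOSED (config_at \<tau> I \<omega> n)))"
proof -
  let ?K = "\<lambda>n. dom (CLOSED (config_at \<tau> I \<omega> n))"
  \<comment> \<open>After \<open>?N\<close> unterminated steps CLOSED would have more elements than
    there are vertices.\<close>
  let ?N = "Suc (card (pverts (graph I)))"
  have sub: "?K n \<subseteq> pverts (graph I) - goals I" for n
    using closed_reach[OF search_inv_config_at] closed_not_goal[OF search_inv_config_at]
      reach_in_pverts by blast
  then have "card (?K ?N) \<le> card (pverts (graph I))"
    by (intro card_mono) auto
  then have terminated: "terminated I (config_at \<tau> I \<omega> ?N)"
    using card_closed_config_at[of ?N] by auto
  have "?K n \<subseteq> ?K ?N" for n
    using closed_config_at_mono config_at_terminated[OF terminated, of n]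
    by (cases "n \<le> ?N") auto
  then have "{v \<in> pverts (graph I) - goals I. \<exists>n. v \<in> ?K n} = ?K ?N"
    using sub by blast
  then show ?thesis
    using that terminated unfolding expansions_def by metis
qed

end

text \<open>A goal generated by a state of \<open>S_less\<close> at depth \<open>opt\<close> would already be in \<open>OPEN\<close> when
  the plateau is entered, in every run.\<close>

lemma no_goal_at_entry:
  assumes inv: "search_inv C" and entry: "min_f_is_Cstar I C" "open_min I C \<inter> goals I = {}"
    and u: "u \<in> S_less I" and t: "t \<in> goals I" "depth t = opt"
  shows "\<not> tight u t"
proof
  assume tight: "tight u t"
  obtain v where v: "v \<in> open_min I C" "fval I C v = opt"
    using entry(1) by (auto simp: min_f_is_Cstar_def Cstar_eq_opt)
  have v_depth: "open_g C v = Some (real (depth v))"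
    using open_min_depth[OF inv v(1)] .
  then have "fopt v = opt"
    using v(2) by (auto simp: fval_def open_g_def fopt_def)
  then have "u \<in> dom (CLOSED C)"
    using open_min_le[OF inv v(1), of u] u by (fastforce simp: S_less_iff)
  moreover have "t \<notin> dom (CLOSED C)"
    using closed_not_goal[OF inv] t(1) by blast
  ultimately obtain a where a: "open_g C t = Some a" "a \<le> real (depth u) + 1"
    using inv_succ[OF inv, of u t] tight unfolding tight_def by blast
  then have "a + heur I t \<le> fopt v"
    using tight t heur_goal \<open>fopt v = opt\<close> unfolding tight_def by simp
  moreover have "fopt v \<le> b + heur I w" if "open_g C w = Some b" for w b
    using v(1) v_depth that by (auto simp: open_min_iff fopt_def)
  ultimately have "t \<in> open_min I C"
    using a(1) unfolding open_min_iff by (meson order_trans)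
  then show False
    using entry(2) t(1) by blast
qed

end

section \<open>Lower bound on the number of expanded plateau states\<close>

text \<open>\<open>no_entry_goal\<close> is the run-independent form of the hypothesis on
  \<open>H\<^sub>0\<close>, obtained from \<open>no_goal_at_entry\<close>; it can thus be applied to
  every run and every path.\<close>

locale perfect_plateau = unit_search_instance I for I :: "'v search_instance" +
  fixes k :: nat
  assumes no_entry_goal: "u \<in> S_less I \<Longrightarrow> t \<in> goals I \<Longrightarrow> depth t = opt \<Longrightarrow> \<not> tight u t"
    and m0_le: "m0 I \<le> real k"
    and perfect: "v \<in> layers_upto I k \<Longrightarrow> ereal (heur I v) = hstar I v"
begin

lemma goal_tight_pred:
  assumes "t \<in> goals I" "reach t" "depth t = opt"
  shows "\<exists>u. reach u \<and> tight u t"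
  using tight_pred[OF assms(2)] start_not_goal assms(1) by metis

lemma tight_pred_goal_S_eq:
  assumes "closed_under_tight_pred K" "u \<in> K" "t \<in> goals I" "depth t = opt" "tight u t"
  shows "u \<in> S_eq I"
  using closed_subset_layers[OF assms(1)] assms no_entry_goal by blast

lemma entry_set_or_tight_pred:
  assumes "closed_under_tight_pred K" "v \<in> K \<inter> S_eq I" "v \<notin> entry_set I"
  shows "\<exists>u \<in> K \<inter> S_eq I. tight u v"
proof -
  have "v \<noteq> start I" "\<forall>u \<in> S_less I. \<not> tight u v"
    using assms(2,3) by (auto simp: entry_set_iff)
  moreover then obtain u where "u \<in> K" "tight u v"
    using assms(1,2) unfolding closed_under_tight_pred_def by blast
  ultimately show ?thesis
    using closed_subset_layers[OF assms(1)] by blast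
qed

text \<open>This makes the \<open>Min\<close> in \<open>m0\<close> meaningful. If the set were
  empty, induction on depth would empty \<open>S_eq\<close>, yet a tight predecessor of an optimal
  goal must lie there by \<open>no_entry_goal\<close>.\<close>

lemma entry_set_nonempty: "entry_set I \<noteq> {}"
proof
  assume empty: "entry_set I = {}"
  have no_S_eq: "v \<notin> S_eq I" if "reach v" for v
    using that
  proof (induction "depth v" arbitrary: v rule: less_induct)
    case less
    show ?case
    proof
      assume v: "v \<in> S_eq I"
      then have "v \<noteq> start I"
        using empty by (auto simp: entry_set_iff)
      then obtain u where u: "reach u" "tight u v"
        using tight_pred less.prems by blast
      have "u \<notin> goals I"
        using opt_le[of u] u S_eq_heur[OF v] by (auto simp: tight_def)
      moreover have "fopt u \<le> opt"
        using fopt_mono[OF u(2)] v by (simp add: S_eq_iff)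
      ultimately have "u \<in> S_less I \<union> S_eq I"
        using u(1) by (auto simp: S_less_iff S_eq_iff)
      then have "u \<in> S_less I"
        using less.hyps[of u] u by (auto simp: tight_def)
      then have "v \<in> entry_set I"
        using u(2) v unfolding entry_set_iff by blast
      then show False
        using empty by simp
    qed
  qed
  obtain t where t: "t \<in> goals I" "reach t" "depth t = opt"
    using opt_attained .
  then obtain u where u: "reach u" "tight u t"
    using goal_tight_pred by blast
  have "u \<notin> goals I"
    using opt_le[of u] u t by (auto simp: tight_def)
  moreover have "fopt u \<le> opt"
    using fopt_mono[OF u(2)] t heur_goal by (simp add: fopt_def)
  ultimately have "u \<in> S_less I \<union> S_eq I"
    using u(1) by (auto simp: S_less_iff S_eq_iff)
  then show False
    using no_S_eq[OF u(1)] no_entry_goal t u by blast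
qed

lemma finite_entry_set: "finite (entry_set I)"
  using finite_layers(2) by (rule rev_finite_subset) (auto simp: entry_set_iff)

lemma m0_le_heur: "v \<in> entry_set I \<Longrightarrow> m0 I \<le> heur I v"
  using finite_entry_set by (simp add: m0_def)

lemma m0_attained: obtains v where "v \<in> entry_set I" "heur I v = m0 I"
proof -
  have "m0 I \<in> heur I ` entry_set I"
    unfolding m0_def using finite_entry_set entry_set_nonempty by (intro Min_in) auto
  then show ?thesis
    using that by auto
qed

text \<open>\<open>m0\<close> as a natural number; the floor is exact since \<open>heur\<close> is
  integral on \<open>S_eq\<close>.\<close>

definition entry_height :: nat where
  "entry_height = nat \<lfloor>m0 I\<rfloor>"

lemma m0_eq: "m0 I = real entry_height"
proof -
  obtain v where "v \<in> entry_set I" "heur I v = m0 I"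
    using m0_attained .
  then have "m0 I = real (opt - depth v)"
    using S_eq_heur[of v] by (auto simp: entry_set_iff)
  then show ?thesis
    unfolding entry_height_def by simp
qed

text \<open>Following tight predecessors backwards from the goal, the heuristic value grows by one per
  step until the plateau is left, which can only happen at a state of \<open>entry_set\<close>.\<close>

lemma plateau_chain:
  assumes K: "closed_under_tight_pred K" and u: "u \<in> K" "tight u t"
    and t: "t \<in> goals I" "depth t = opt" and i: "Suc i \<le> entry_height"
  shows "\<exists>v \<in> K \<inter> S_eq I. heur I v = real (Suc i)"
  using i
proof (induction i)
  case 0
  have "u \<in> K \<inter> S_eq I"
    using tight_pred_goal_S_eq[OF K u(1) t u(2)] u(1) by blast
  moreover have "heur I u = 1"
    using S_eq_heur[of u] calculation u(2) t(2) by (auto simp: tight_def)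
  ultimately show ?case by auto
next
  case (Suc i)
  then obtain v where v: "v \<in> K \<inter> S_eq I" "heur I v = real (Suc i)"
    by auto
  \<comment> \<open>Here \<open>heur I v\<close> is i + 1 with i + 2 <= \<open>entry_height\<close>,
    hence strictly below \<open>m0\<close>.\<close>
  then have "v \<notin> entry_set I"
    using m0_le_heur[of v] Suc.prems by (auto simp: m0_eq)
  then obtain w where w: "w \<in> K \<inter> S_eq I" "tight w v"
    using entry_set_or_tight_pred[OF K v(1)] by blast
  then have "heur I w = real (Suc (Suc i))"
    using S_eq_heur[of w] S_eq_heur[of v] v by (auto simp: tight_def)
  with w(1) show ?case by blast
qed

text \<open>The values 1, ..., \<open>entry_height\<close> of \<open>heur\<close> are all attained
  on this set, at different states.\<close>

lemma entry_height_le_card: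
  assumes "closed_under_tight_pred K" "u \<in> K" "tight u t" "t \<in> goals I" "depth t = opt"
  shows "entry_height \<le> card (K \<inter> S_eq I)"
proof -
  have fin: "finite (K \<inter> S_eq I)"
    using finite_layers by auto
  have "(\<lambda>i. real (Suc i)) ` {..<entry_height} \<subseteq> heur I ` (K \<inter> S_eq I)"
    using plateau_chain[OF assms] by (force simp: image_iff Suc_le_eq)
  then have "card ((\<lambda>i. real (Suc i)) ` {..<entry_height}) \<le> card (heur I ` (K \<inter> S_eq I))"
    using fin by (intro card_mono) auto
  also have "\<dots> \<le> card (K \<inter> S_eq I)"
    using fin by (rule card_image_le)
  finally show ?thesis
    by (simp add: card_image inj_on_def)
qed

text \<open>The goal in OPEN_min has f-value \<open>opt\<close>, so every state of smaller f-value
  is already closed, and its tight predecessor in CLOSED starts the chain.\<close>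

lemma terminal_config:
  assumes inv: "search_inv C" and "terminated I C"
  shows "card (dom (CLOSED C)) = card (S_less I) + card (dom (CLOSED C) \<inter> S_eq I)"
    and "entry_height \<le> card (dom (CLOSED C) \<inter> S_eq I)"
proof -
  let ?K = "dom (CLOSED C)"
  obtain t where t: "t \<in> open_min I C" "t \<in> goals I"
    using assms terminated_iff by blast
  have "reach t"
    using open_min_reach[OF inv t(1)] .
  then have depth_t: "depth t = opt"
    using open_min_le_opt[OF inv t(1)] opt_le[OF t(2)] heur_goal[OF t(2)] by (simp add: fopt_def)
  obtain u where "u \<in> ?K" "tight u t"
    using open_min_tight_pred[OF inv t(1)] t(2) start_not_goal by blast
  then show "entry_height \<le> card (?K \<inter> S_eq I)"
    using entry_height_le_card[OF inv_closed[OF inv]] t(2) depth_t by blast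
  have "S_less I \<subseteq> ?K"
    using open_min_le[OF inv t(1)] depth_t heur_goal[OF t(2)]
    by (fastforce simp: S_less_iff fopt_def)
  then have "?K = S_less I \<union> (?K \<inter> S_eq I)"
    using closed_subset_layers[OF inv_closed[OF inv]] by blast
  moreover have "S_less I \<inter> (?K \<inter> S_eq I) = {}"
    by (auto simp: S_less_iff S_eq_iff)
  ultimately show "card ?K = card (S_less I) + card (?K \<inter> S_eq I)"
    using finite_layers by (metis card_Un_disjoint finite_Int)
qed

section \<open>Descent of low-h runs and the exact count\<close>

lemma perfect_awalk:
  assumes v: "v \<in> S_eq I" "heur I v = real j" and j: "j \<le> entry_height"
  obtains p t where "t \<in> goals I" "awalk v p t" "length p = j"
proof -
  have "0 < j"
    using heur_pos[of v] v by (simp add: S_eq_iff)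
  moreover have "j \<le> k"
    using j m0_le by (simp add: m0_eq)
  ultimately have "v \<in> layers_upto I k"
    using v by (force simp: layers_upto_def layer_def)
  \<comment> \<open>Walk lengths are integers, so cost below j + 1 already means length at most
    j.\<close>
  then have "(INF t \<in> goals I. \<mu> (cost I) v t) < ereal (real j + 1)"
    using perfect v(2) unfolding hstar_def by (metis ereal_less_eq(3) leD le_less_linear less_add_one)
  then obtain t where t: "t \<in> goals I" "\<mu> (cost I) v t < ereal (real j + 1)"
    unfolding INF_less_iff by blast
  then obtain p where p: "awalk v p t" "awalk_cost (cost I) p < real j + 1"
    unfolding \<mu>_def INF_less_iff by auto
  then have "length p \<le> j"
    by (simp add: awalk_cost_eq_length)
  moreover have "j \<le> length p"
    using heur_le_awalk[OF p(1)] heur_goal[OF t(1)] v(2) by simp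
  ultimately show ?thesis
    using that t(1) p(1) by simp
qed

text \<open>\<open>w\<close> is the second state of a walk of length \<open>heur I v\<close> to a
  goal. It may itself be a goal when \<open>j = 0\<close>, so the conclusion is
  \<open>fopt w = opt\<close> rather than membership in \<open>S_eq\<close>.\<close>

lemma perfect_succ:
  assumes v: "v \<in> S_eq I" "heur I v = real (Suc j)" and j: "Suc j \<le> entry_height"
  obtains w where "tight v w" "reach w" "heur I w = real j" "fopt w = opt"
proof -
  have v_reach: "reach v" and v_depth: "depth v + Suc j = opt"
    using v S_eq_heur[OF v(1)] by (auto simp: S_eq_iff)
  obtain p t where t: "t \<in> goals I" and p: "awalk v p t" "length p = Suc j"
    using perfect_awalk[OF v j] .
  then obtain w q where q: "edge v w" "awalk w q t" "length q = j"
    by (cases p) (auto simp: awalk_Cons_iff)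
  have "heur I w = real j"
    using heur_le_awalk[OF q(2)] heur_edge[OF q(1)] heur_goal[OF t] q(3) v(2) by simp
  moreover have w: "reach w" "depth w \<le> Suc (depth v)"
    using depth_edge[OF v_reach q(1)] by auto
  moreover have "opt \<le> depth w + j"
    using depth_awalk_le[OF w(1) q(2)] opt_le[OF t] q(3) by simp
  moreover have "depth w = Suc (depth v)"
    using calculation v_depth by simp
  ultimately show ?thesis
    using that[of w] q(1) v_depth by (simp add: tight_def fopt_def)
qed

lemma open_g_of_tight:
  assumes inv: "search_inv C" and "u \<in> dom (CLOSED C)" "v \<notin> dom (CLOSED C)" "tight u v"
  shows "open_g C v = Some (real (depth v))"
proof -
  obtain a where a: "open_g C v = Some a" "a \<le> real (depth u) + 1"
    using inv_succ[OF inv, of u v] assms unfolding tight_def by blast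
  moreover have "real (depth v) \<le> a"
    using open_reach(2)[OF inv a(1)] .
  ultimately show ?thesis
    using assms(4) by (simp add: tight_def)
qed

text \<open>After the plateau has been entered, a low-\<open>h\<close> run descends straight to a goal: with \<open>j\<close>
  steps to go it has expanded one plateau state per value \<open>j + 1, \<dots>, entry_height\<close> of \<open>h\<close>.\<close>

definition descending :: "'v config \<Rightarrow> nat \<Rightarrow> bool" where
  "descending C j \<longleftrightarrow>
    S_less I \<subseteq> dom (CLOSED C) \<and>
    card (dom (CLOSED C) \<inter> S_eq I) + j = entry_height \<and>
    (\<forall>v \<in> dom (CLOSED C) \<inter> S_eq I. real j < heur I v) \<and>
    (\<exists>w. open_g C w = Some (real (depth w)) \<and> fopt w = opt \<and> heur I w = real j)"

text \<open>A state of \<open>entry_set\<close> attaining \<open>m0\<close> serves as the first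
  witness: it is the start or has a tight predecessor in \<open>S_less\<close>, so it is in OPEN
  with optimal g.\<close>

lemma descending_start:
  assumes inv: "search_inv C" and "dom (CLOSED C) \<inter> S_eq I = {}" "S_less I \<subseteq> dom (CLOSED C)"
  shows "descending C entry_height"
proof -
  obtain v where v: "v \<in> entry_set I" "heur I v = m0 I"
    using m0_attained .
  then have v_eq: "v \<in> S_eq I" and v_open: "v \<notin> dom (CLOSED C)"
    using assms(2) by (auto simp: entry_set_iff)
  have "open_g C v = Some (real (depth v))"
  proof (cases "v = start I")
    case True
    then obtain a where "open_g C v = Some a" "a \<le> 0"
      using inv_start[OF inv] v_open by blast
    moreover from this have "0 \<le> a"
      using open_reach(2)[OF inv, of v a] by simp
    ultimately show ?thesis
      using True by simp
  next
    case False
    then obtain u where "u \<in> S_less I" "tight u v"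
      using v(1) by (auto simp: entry_set_iff)
    then show ?thesis
      using open_g_of_tight[OF inv] assms(3) v_open by blast
  qed
  then show ?thesis
    using assms v(2) v_eq unfolding descending_def by (auto simp: m0_eq S_eq_iff)
qed

text \<open>Together with the witness in \<open>descending\<close>, this pins the low-h choice to
  the value \<open>j\<close> exactly.\<close>

lemma heur_open_min_ge:
  assumes inv: "search_inv C" and desc: "descending C j"
    and u: "u \<in> open_min I C" "u \<in> S_eq I"
  shows "real j \<le> heur I u"
proof (cases "u \<in> entry_set I")
  case True
  have "j \<le> entry_height"
    using desc by (auto simp: descending_def)
  then show ?thesis
    using m0_le_heur[OF True] by (simp add: m0_eq)
next
  case False
  then have "u \<noteq> start I" "\<forall>x \<in> S_less I. \<not> tight x u"
    using u(2) by (auto simp: entry_set_iff)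
  moreover then obtain x where x: "x \<in> dom (CLOSED C)" "tight x u"
    using open_min_tight_pred[OF inv u(1)] by blast
  ultimately have "x \<in> dom (CLOSED C) \<inter> S_eq I"
    using closed_subset_layers[OF inv_closed[OF inv]] by blast
  then have "real j < heur I x"
    using desc by (auto simp: descending_def)
  moreover have "heur I x = real (opt - depth x)" "heur I u = real (opt - depth u)"
    using S_eq_heur u(2) \<open>x \<in> dom (CLOSED C) \<inter> S_eq I\<close> by blast+
  ultimately show ?thesis
    using x(2) by (simp add: tight_def)
qed

lemma descending_expand:
  assumes inv: "search_inv C" and desc: "descending C j" and nt: "\<not> terminated I C"
    and u: "u \<in> open_min I C" "u \<notin> goals I"
    and low: "\<And>x. x \<in> open_min I C - goals I \<Longrightarrow> heur I u \<le> heur I x"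
  shows "\<exists>i. descending (expand I u C) i"
proof -
  let ?K = "dom (CLOSED C)"
  have desc1: "S_less I \<subseteq> ?K" and desc2: "card (?K \<inter> S_eq I) + j = entry_height"
    and desc3: "\<And>v. v \<in> ?K \<inter> S_eq I \<Longrightarrow> real j < heur I v"
    using desc unfolding descending_def by blast+
  obtain w where w: "open_g C w = Some (real (depth w))" "fopt w = opt" "heur I w = real j"
    using desc unfolding descending_def by blast
  have u_reach: "reach u" and u_K: "u \<notin> ?K" and u_g: "open_g C u = Some (real (depth u))"
    using open_min_reach[OF inv u(1)] open_min_not_closed[OF inv u(1)]
      open_min_depth[OF inv u(1)] by auto
  then have u_eq: "u \<in> S_eq I"
    using open_min_le_opt[OF inv u(1)] u(2) desc1 S_less_iff[of u] S_eq_iff[of u] by force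
  have "fopt u \<le> b + heur I x" if "open_g C x = Some b" for x b
    using u(1) u_g that by (auto simp: open_min_iff fopt_def)
  then have "w \<in> open_min I C"
    using w u_eq unfolding open_min_iff S_eq_iff fopt_def by auto
  \<comment> \<open>A goal among the minimal states would have ended the search.\<close>
  moreover have "w \<notin> goals I"
    using calculation nt terminated_iff[OF inv] by blast
  ultimately have "heur I u = real j"
    using low[of w] w(3) heur_open_min_ge[OF inv desc u(1) u_eq] by simp
  moreover obtain i where i: "j = Suc i"
    using calculation heur_pos[OF u_reach u(2)] by (cases j) auto
  ultimately obtain x where x: "tight u x" "reach x" "heur I x = real i" "fopt x = opt"
    using perfect_succ[OF u_eq, of i] desc2 by auto
  have K': "dom (CLOSED (expand I u C)) = insert u ?K"
    by (rule CLOSED_expand)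
  \<comment> \<open>Closed plateau states have \<open>heur\<close> above \<open>j\<close>, while
    \<open>x\<close> has j - 1; so \<open>x\<close> is still to be expanded and is the next
    witness.\<close>
  have "x \<notin> ?K"
  proof
    assume "x \<in> ?K"
    moreover from this have "x \<in> S_eq I"
      using closed_not_goal[OF inv] x by (auto simp: S_eq_iff)
    ultimately show False
      using desc3[of x] x(3) i by simp
  qed
  moreover have "x \<noteq> u"
    using x(1) by (auto simp: tight_def)
  ultimately have "open_g (expand I u C) x = Some (real (depth x))"
    using open_g_of_tight[OF search_inv_expand[OF inv u], of u x] x(1) by (simp add: K')
  moreover have "insert u ?K \<inter> S_eq I = insert u (?K \<inter> S_eq I)"
    using u_eq by auto
  moreover have "card (insert u (?K \<inter> S_eq I)) = Suc (card (?K \<inter> S_eq I))"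
    using u_K finite_layers by auto
  moreover have "real i < heur I v" if "v \<in> insert u (?K \<inter> S_eq I)" for v
  proof -
    have "v = u \<or> real j < heur I v"
      using that desc3 by blast
    then show ?thesis
      using i \<open>heur I u = real j\<close> by auto
  qed
  ultimately have "descending (expand I u C) i"
    unfolding descending_def K' using desc1 desc2 x(3,4) i
    by (intro conjI exI[of _ x]) (simp_all add: subset_insertI2)
  then show ?thesis ..
qed

lemma low_h_choice:
  assumes "is_tie_breaker \<sigma>" "finite S" "S \<noteq> {}"
  shows "low_h \<sigma> I \<omega> H S \<in> {v \<in> S. \<forall>u \<in> S. heur I v \<le> heur I u}"
proof -
  let ?M = "{v \<in> S. \<forall>u \<in> S. heur I v \<le> heur I u}"
  have "arg_min_on (heur I) S \<in> ?M"
    using assms(2,3) by (auto simp: arg_min_if_finite(1) intro: arg_min_least)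
  then have "finite ?M" "?M \<noteq> {}"
    using assms(2) by auto
  then show ?thesis
    using assms(1) unfolding is_tie_breaker_def low_h_def by blast
qed

lemma low_h_descending:
  fixes \<sigma> :: "('v, 'w) tie_breaker"
  assumes \<sigma>: "is_tie_breaker \<sigma>"
  shows "dom (CLOSED (config_at (low_h \<sigma>) I \<omega> n)) \<inter> S_eq I = {}
    \<or> (\<exists>j. descending (config_at (low_h \<sigma>) I \<omega> n) j)"
proof (induction n)
  case 0
  show ?case by (simp add: initial_config_def)
next
  case (Suc n)
  let ?C = "config_at (low_h \<sigma>) I \<omega> n" and ?C' = "config_at (low_h \<sigma>) I \<omega> (Suc n)"
  have inv: "search_inv ?C"
    by (rule search_inv_config_at[OF is_tie_breaker_low_h[OF \<sigma>]])
  show ?case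
  proof (cases "terminated I ?C")
    case True
    then show ?thesis using Suc by (simp add: config_at_Suc)
  next
    case nt: False
    define u where "u = low_h \<sigma> I \<omega> (history (low_h \<sigma>) I \<omega> n) (open_min I ?C - goals I)"
    have C': "?C' = expand I u ?C"
      using nt by (simp add: config_at_Suc u_def)
    have "u \<in> {v \<in> open_min I ?C - goals I. \<forall>x \<in> open_min I ?C - goals I. heur I v \<le> heur I x}"
      unfolding u_def
      using finite_open_min[OF inv] open_min_nonempty[OF inv] nt terminated_iff[OF inv]
      by (intro low_h_choice[OF \<sigma>]) auto
    then have u: "u \<in> open_min I ?C" "u \<notin> goals I"
      and low: "\<And>x. x \<in> open_min I ?C - goals I \<Longrightarrow> heur I u \<le> heur I x"
      by blast+
    show ?thesis
    proof (cases "\<exists>j. descending ?C j")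
      case True
      then show ?thesis
        using descending_expand[OF inv _ nt u low] unfolding C' by blast
    next
      case False
      then have empty: "dom (CLOSED ?C) \<inter> S_eq I = {}"
        using Suc by blast
      show ?thesis
      proof (cases "u \<in> S_eq I")
        case True
        \<comment> \<open>Choosing a plateau state means that all of \<open>S_less\<close> is
          closed; then \<open>?C\<close> would already be descending, so this branch is
          contradictory.\<close>
        have "S_less I \<subseteq> dom (CLOSED ?C)"
        proof
          fix x assume x: "x \<in> S_less I"
          then have "\<not> fopt u \<le> fopt x"
            using True by (simp add: S_less_iff S_eq_iff)
          then show "x \<in> dom (CLOSED ?C)"
            using open_min_le[OF inv u(1), of x] x unfolding S_less_iff by blast
        qed
        then show ?thesis
          using False descending_start[OF inv empty] by blast
      next
        case False
        then show ?thesis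
          using empty unfolding C' CLOSED_expand by blast
      qed
    qed
  qed
qed

lemma expansions_ge:
  assumes "is_tie_breaker \<tau>"
  shows "card (S_less I) + entry_height \<le> expansions \<tau> I \<omega>"
proof -
  obtain n where "terminated I (config_at \<tau> I \<omega> n)"
    "expansions \<tau> I \<omega> = card (dom (CLOSED (config_at \<tau> I \<omega> n)))"
    using expansions_eq[OF assms] .
  then show ?thesis
    using terminal_config[OF search_inv_config_at[OF assms]] by simp
qed

text \<open>The descent supplies only the upper bound, since \<open>descending\<close> caps the
  closed plateau states at \<open>entry_height\<close>; equality comes from the bound valid for
  every run.\<close>

lemma expansions_low_h:
  assumes "is_tie_breaker \<sigma>"
  shows "expansions (low_h \<sigma>) I \<omega> = card (S_less I) + entry_height"
proof -
  have tb: "is_tie_breaker (low_h \<sigma>)"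
    using assms by (rule is_tie_breaker_low_h)
  obtain n where "terminated I (config_at (low_h \<sigma>) I \<omega> n)"
    and "expansions (low_h \<sigma>) I \<omega> = card (dom (CLOSED (config_at (low_h \<sigma>) I \<omega> n)))"
    using expansions_eq[OF tb] .
  then have "expansions (low_h \<sigma>) I \<omega> =
      card (S_less I) + card (dom (CLOSED (config_at (low_h \<sigma>) I \<omega> n)) \<inter> S_eq I)"
    using terminal_config(1)[OF search_inv_config_at[OF tb]] by simp
  moreover have "card (dom (CLOSED (config_at (low_h \<sigma>) I \<omega> n)) \<inter> S_eq I) \<le> entry_height"
    using low_h_descending[OF assms, of \<omega> n] by (auto simp: descending_def)
  ultimately show ?thesis
    using expansions_ge[OF tb, of \<omega>] by simp
qed

lemma Min_expansions:
  fixes \<sigma> :: "('v, 'w) tie_breaker"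
  assumes "is_tie_breaker \<sigma>"
  shows "Min {expansions \<tau> I \<omega>' | (\<tau> :: ('v, 'w) tie_breaker) \<omega>'. is_tie_breaker \<tau>}
    = expansions (low_h \<sigma>) I \<omega>"
proof (rule Min_eqI)
  have "expansions \<tau> I \<omega>' \<le> card (pverts (graph I))" for \<tau> :: "('v, 'w) tie_breaker" and \<omega>'
    unfolding expansions_def by (intro card_mono) auto
  then show "finite {expansions \<tau> I \<omega>' | (\<tau> :: ('v, 'w) tie_breaker) \<omega>'. is_tie_breaker \<tau>}"
    by (intro finite_subset[OF _ finite_atMost[of "card (pverts (graph I))"]]) auto
  show "expansions (low_h \<sigma>) I \<omega>
      \<in> {expansions \<tau> I \<omega>' | (\<tau> :: ('v, 'w) tie_breaker) \<omega>'. is_tie_breaker \<tau>}"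
    using is_tie_breaker_low_h[OF assms] by blast
qed (auto simp: expansions_low_h[OF assms] expansions_ge)

section \<open>Optimal paths and \<open>ell_star\<close>\<close>

text \<open>A shorter route to \<open>v\<close> would reach the goal in fewer than
  \<open>opt\<close> steps; consistency along \<open>r\<close> bounds \<open>heur I v\<close> by
  \<open>length r\<close>.\<close>

lemma optimal_awalk_split:
  assumes t: "t \<in> goals I" and len: "length q + length r = opt"
    and q: "awalk (start I) q v" and r: "awalk v r t"
  shows "depth v = length q" "fopt v \<le> opt"
proof -
  have v: "reach v"
    using q by (rule reachable_awalkI)
  have "opt \<le> depth v + length r"
    using depth_awalk_le[OF v r] opt_le[OF t] by simp
  then show "depth v = length q"
    using depth_le[OF q] len by simp
  then show "fopt v \<le> opt"
    using heur_le_awalk[OF r] heur_goal[OF t] len by (simp add: fopt_def)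
qed

context
  fixes p t
  assumes t: "t \<in> goals I" and p: "awalk (start I) p t" and len: "length p = opt"
begin

abbreviation "walk_verts \<equiv> set (pawalk_verts (start I) p)"

lemma walk_vert:
  assumes "v \<in> walk_verts"
  shows "reach v" "depth v \<le> opt" "fopt v \<le> opt" "v \<in> goals I \<Longrightarrow> v = t"
proof -
  obtain q r where qr: "p = q @ r" "awalk (start I) q v" "awalk v r t"
    using awalk_decomp[OF p assms] by blast
  show v: "reach v"
    using qr(2) by (rule reachable_awalkI)
  have depth: "depth v = length q" and "fopt v \<le> opt"
    using optimal_awalk_split[OF t _ qr(2,3)] len qr(1) by auto
  then show "fopt v \<le> opt" "depth v \<le> opt"
    using len qr(1) by auto
  show "v = t" if "v \<in> goals I"
  proof -
    \<comment> \<open>A goal with a nonempty remainder would lie at depth below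
      \<open>opt\<close>.\<close>
    have "r = []"
      using opt_le[OF that v] depth len unfolding qr(1) by (cases r) auto
    then show ?thesis
      using qr(3) by (simp add: awalk_Nil_iff)
  qed
qed

lemma walk_tight_pred:
  assumes v: "v \<in> walk_verts" "v \<noteq> start I"
  shows "\<exists>u \<in> walk_verts - goals I. tight u v"
proof -
  obtain q r where qr: "p = q @ r" "awalk (start I) q v" "awalk v r t"
    using awalk_decomp[OF p v(1)] by blast
  then obtain q' e where q': "q = q' @ [e]"
    using v(2) by (cases q rule: rev_cases) (auto simp: awalk_Nil_iff)
  then have e: "awalk (start I) q' (fst e)" "edge (fst e) v" "snd e = v"
    using qr(2) by (auto simp: awalk_simps)
  then have "awalk (fst e) (e # r) t"
    using qr(3) in_arcsD1 by (cases e) (auto simp: awalk_Cons_iff)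
  then have "depth (fst e) = length q'"
    using optimal_awalk_split(1)[OF t _ e(1), of "e # r"] len qr(1) q' by simp
  moreover have "depth v = length q"
    using optimal_awalk_split(1)[OF t _ qr(2,3)] len qr(1) by simp
  ultimately have tight: "tight (fst e) v"
    using e(2) q' by (simp add: tight_def)
  have "fst e \<notin> goals I"
    using opt_le[of "fst e"] reachable_awalkI[OF e(1)] \<open>depth (fst e) = length q'\<close> len qr(1) q'
    by auto
  moreover have "fst e \<in> walk_verts"
    by (rule awalk_verts_arc1) (simp add: qr(1) q')
  ultimately show ?thesis
    using tight by blast
qed

lemma entry_height_le_walk: "entry_height \<le> card ((walk_verts - goals I) \<inter> S_eq I)"
proof -
  have "closed_under_tight_pred (walk_verts - goals I)"
    unfolding closed_under_tight_pred_def using walk_vert walk_tight_pred by blast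
  moreover have t_vert: "t \<in> walk_verts"
    using p by auto
  then obtain u where "u \<in> walk_verts - goals I" "tight u t"
    using walk_tight_pred t start_not_goal by metis
  moreover have "depth t = opt"
    using walk_vert[OF t_vert] opt_le t by (simp add: le_antisym)
  ultimately show ?thesis
    using entry_height_le_card t by blast
qed

end

text \<open>Reach \<open>v\<close> through a tight predecessor in \<open>S_less\<close>: along a
  shortest walk to that state f never exceeds its value, so the walk avoids \<open>S_eq\<close>
  until \<open>v\<close>.\<close>

lemma entry_awalk:
  assumes v: "v \<in> entry_set I"
  obtains q where "awalk (start I) q v" "length q = depth v"
    "set (pawalk_verts (start I) q) \<inter> S_eq I \<subseteq> {v}"
proof (cases "v = start I")
  case True
  then show ?thesis
    using that[of "[]"] start_in by (auto simp: awalk_Nil_iff)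
next
  case False
  then obtain u where u: "u \<in> S_less I" "tight u v"
    using v by (auto simp: entry_set_iff)
  then have u_reach: "reach u"
    by (simp add: S_less_iff)
  obtain q where q: "awalk (start I) q u" "length q = depth u"
    using depth_awalk[OF u_reach] .
  have "x \<notin> S_eq I" if x: "x \<in> set (pawalk_verts (start I) q)" for x
  proof -
    obtain a b where ab: "q = a @ b" "awalk (start I) a x" "awalk x b u"
      using awalk_decomp[OF q(1) x] by blast
    then have "fopt x \<le> fopt u"
      using depth_le[OF ab(2)] heur_le_awalk[OF ab(3)] q(2) by (simp add: fopt_def)
    then show ?thesis
      using u(1) by (simp add: S_less_iff S_eq_iff)
  qed
  moreover have uv: "awalk u [(u, v)] v"
    using u(2) edge_awalk by (simp add: tight_def)
  then have walk: "awalk (start I) (q @ [(u, v)]) v"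
    using q(1) by (rule awalk_appendI[rotated])
  moreover have "set (pawalk_verts (start I) (q @ [(u, v)])) \<subseteq> insert v (set (pawalk_verts (start I) q))"
    unfolding set_awalk_verts_append[OF q(1) uv] using q(1) by auto
  ultimately show ?thesis
    using that[of "q @ [(u, v)]"] q(2) u(2) by (fastforce simp: tight_def)
qed

text \<open>Removing cycles cannot lengthen the walk, and no walk to a goal is shorter than
  \<open>opt\<close>; so the resulting simple path is still optimal.\<close>

lemma optimal_path_of_awalk:
  assumes t: "t \<in> goals I" and p: "awalk (start I) p t" "length p = opt"
  obtains P where "P \<in> optimal_path_sets I" "P \<subseteq> set (pawalk_verts (start I) p)"
proof -
  define p' where "p' = awalk_to_apath p"
  have path: "apath (start I) p' t"
    unfolding p'_def using p(1) by (rule apath_awalk_to_apath)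
  then have p': "awalk (start I) p' t"
    by (rule awalkI_apath)
  have "awalk_cost (cost I) p' \<le> awalk_cost (cost I) p"
    unfolding p'_def using p(1)
    by (rule awalk_to_path_no_neg_cyc_cost) (auto simp: awalk_cost_eq_length)
  then have len: "length p' = opt"
    using p p' opt_le[OF t reachable_awalkI[OF p']] depth_le[OF p']
    by (simp add: awalk_cost_eq_length)
  have "t \<in> set (pawalk_verts (start I) p')"
    using p' by auto
  then have "set (pawalk_verts (start I) p') \<inter> goals I = {t}"
    using walk_vert(4)[OF t p' len] t by blast
  then have "set (pawalk_verts (start I) p') \<in> optimal_path_sets I"
    unfolding optimal_path_sets_def awalk_verts_with_proj_eq
    using t path awalk_cost_eq_length[OF p'] len Cstar_eq_opt by force
  moreover have "set (pawalk_verts (start I) p') \<subseteq> set (pawalk_verts (start I) p)"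
    using awalk_to_apath_subset[OF p(1)]
    unfolding set_awalk_verts[OF p'] set_awalk_verts[OF p(1)] unfolding p'_def by auto
  ultimately show ?thesis
    by (rule that)
qed

text \<open>Join a walk to an entry state of least \<open>heur\<close> with a walk of length
  \<open>m0\<close> from there to a goal, as provided by the perfect heuristic.\<close>

lemma ex_optimal_path:
  obtains P where "P \<in> optimal_path_sets I" "card ((P - goals I) \<inter> S_eq I) \<le> entry_height"
proof -
  obtain v where v: "v \<in> entry_set I" "heur I v = real entry_height"
    using m0_attained m0_eq by metis
  then have v_eq: "v \<in> S_eq I"
    by (simp add: entry_set_iff)
  obtain r t where t: "t \<in> goals I" and r: "awalk v r t" "length r = entry_height"
    using perfect_awalk[OF v_eq v(2) order_refl] .
  obtain q where q: "awalk (start I) q v" "length q = depth v"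
    and q_S_eq: "set (pawalk_verts (start I) q) \<inter> S_eq I \<subseteq> {v}"
    using entry_awalk[OF v(1)] .
  have qr: "awalk (start I) (q @ r) t"
    using q(1) r(1) by (rule awalk_appendI)
  have "length (q @ r) = opt"
    using S_eq_heur[OF v_eq] v(2) q(2) r(2) by simp
  then obtain P where P: "P \<in> optimal_path_sets I" "P \<subseteq> set (pawalk_verts (start I) (q @ r))"
    using optimal_path_of_awalk[OF t qr] by blast
  let ?R = "set (pawalk_verts v r)"
  have "t \<in> ?R" "v \<in> ?R"
    using hd_in_awalk_verts(1)[OF r(1)] r(1) by auto
  have "set (pawalk_verts (start I) (q @ r)) = set (pawalk_verts (start I) q) \<union> ?R"
    using set_awalk_verts_append[OF q(1) r(1)] .
  then have "(P - goals I) \<inter> S_eq I \<subseteq> ?R - {t}"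
    using P(2) q_S_eq t \<open>v \<in> ?R\<close> by blast
  then have "card ((P - goals I) \<inter> S_eq I) \<le> card (?R - {t})"
    by (intro card_mono) auto
  also have "\<dots> = card ?R - 1"
    using \<open>t \<in> ?R\<close> by (rule card_Diff_singleton)
  \<comment> \<open>\<open>r\<close> has \<open>entry_height + 1\<close> listed vertices, and the
    goal \<open>t\<close> has been removed.\<close>
  also have "\<dots> \<le> entry_height"
    using card_length[of "awalk_verts v r"] length_awalk_verts[of v r] r(2) by linarith
  finally show ?thesis
    using that P(1) by blast
qed

lemma ell_star_eq: "ell_star I = entry_height"
proof -
  let ?f = "\<lambda>P. card ((P - goals I) \<inter> S_eq I)"
  have lower: "entry_height \<le> ?f P" if P: "P \<in> optimal_path_sets I" for P
  proof -
    obtain p t where P_eq: "P = set (pawalk_verts (start I) p)" and t: "t \<in> goals I"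
      and path: "apath (start I) p t" and cost: "ereal (awalk_cost (cost I) p) = Cstar I"
      using P unfolding optimal_path_sets_def awalk_verts_with_proj_eq by blast
    have p: "awalk (start I) p t"
      using path by (rule awalkI_apath)
    moreover have "length p = opt"
      using cost awalk_cost_eq_length[OF p] by (simp add: Cstar_eq_opt)
    ultimately show ?thesis
      unfolding P_eq by (rule entry_height_le_walk[OF t])
  qed
  obtain P where P: "P \<in> optimal_path_sets I" "?f P \<le> entry_height"
    using ex_optimal_path .
  have "?f Q \<le> card (S_eq I)" for Q
    using finite_layers by (intro card_mono) auto
  then have "finite (?f ` optimal_path_sets I)"
    by (intro finite_subset[OF _ finite_atMost[of "card (S_eq I)"]]) auto
  moreover have "entry_height \<in> ?f ` optimal_path_sets I"
    using P lower[OF P(1)] by (metis (no_types, lifting) image_eqI le_antisym)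
  ultimately show ?thesis
    unfolding ell_star_def using lower by (intro Min_eqI) auto
qed

end

theorem corollary1:
  fixes I :: "'v search_instance" and k :: nat
    and \<tau>\<^sub>0 \<sigma> :: "('v, 'w) tie_breaker" and \<omega>\<^sub>0 \<omega> :: 'w and H\<^sub>0 :: "'v config"
  assumes "wf_search_instance I"
    and "solvable I"
    and "\<forall>a \<in> parcs (graph I). cost I a = 1"
    and "consistent I"
    and "\<forall>v \<in> goals I. heur I v = 0"
    and "\<forall>v \<in> pverts (graph I) - goals I. heur I v > 0"
    and "k \<ge> 1"
    and "is_tie_breaker \<tau>\<^sub>0" and "plateau_entry \<tau>\<^sub>0 I \<omega>\<^sub>0 H\<^sub>0"
    and "open_min I H\<^sub>0 \<inter> goals I = {}"
    and "m0 I \<le> real k"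
    and "\<forall>v \<in> layers_upto I k. ereal (heur I v) = hstar I v"
    and "is_tie_breaker \<sigma>"
  shows "Min {expansions \<tau> I \<omega>' | (\<tau> :: ('v, 'w) tie_breaker) \<omega>'. is_tie_breaker \<tau>}
           = expansions (low_h \<sigma>) I \<omega>
       \<and> real (expansions (low_h \<sigma>) I \<omega>) = real (card (S_less I)) + m0 I
       \<and> real (card (S_less I)) + m0 I = real (card (S_less I)) + real (ell_star I)"
proof -
  interpret wf_search_instance I
    by fact
  interpret unit_search_instance I
    using assms by unfold_locales auto
  have "search_inv H\<^sub>0" "min_f_is_Cstar I H\<^sub>0"
    using assms(9) search_inv_config_at[OF assms(8)] by (auto simp: plateau_entry_def)
  \<comment> \<open>The reference run is used here only, to discharge
    \<open>no_entry_goal\<close>.\<close>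
  then interpret perfect_plateau I k
    using assms(10-12) no_goal_at_entry by unfold_locales blast+
  show ?thesis
    using Min_expansions[OF assms(13)] expansions_low_h[OF assms(13)]
    by (simp add: m0_eq ell_star_eq)
qed

end
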